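(* Let $(X,d,\preceq)$ be an ordered metric space, $F:X^{n}\to X$ a mapping and $\ast\in\mathcal{U}_{\iota_n}$. Let $E$ be an O-complete subspace of $X$ such that $F(X^n)\subseteq E$. Suppose that the following conditions (i)-(iii) hold: (i) $F$ has the $\iota_n$-mixed monotone property; (ii) either $F$ is O-continuous or $(E,d,\preceq)$ has the MCB property; (iii) there exist $x^{(0)}_1,\dots,x^{(0)}_n\in X$ such that either [$x^{(0)}_i\preceq F(x^{(0)}_{i_1},\dots,x^{(0)}_{i_n})$ for each $i\in A$ and $x^{(0)}_i\succeq F(x^{(0)}_{i_1},\dots,x^{(0)}_{i_n})$ for each $i\in B$], or [$x^{(0)}_i\succeq F(x^{(0)}_{i_1},\dots,x^{(0)}_{i_n})$ for each $i\in A$ and $x^{(0)}_i\preceq F(x^{(0)}_{i_1},\dots,x^{(0)}_{i_n})$ for each $i\in B$]. Suppose moreover that at least one of the following two conditions holds: (iv) there exists $\varphi\in\Omega$ such that $$\frac1n\sum_{i=1}^n d\big(F(x_{i_1},\dots,x_{i_n}),F(y_{i_1},\dots,y_{i_n})\big)\le\varphi\Big(\frac1n\sum_{i=1}^n d(x_i,y_i)\Big)$$ for all $(x_1,\dots,x_n),(y_1,\dots,y_n)\in X^n$ that are comparable with respect to $\sqsubseteq_{\iota_n}$; (iv$'$) there exists $\varphi\in\Omega$ such that $$\max_{i\in I_n} d\big(F(x_{i_1},\dots,x_{i_n}),F(y_{i_1},\dots,y_{i_n})\big)\le\varphi\Big(\max_{i\in I_n} d(x_i,y_i)\Big)$$ for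 all $(x_1,\dots,x_n),(y_1,\dots,y_n)\in X^n$ that are comparable with respect to $\sqsubseteq_{\iota_n}$. Suppose in addition that for every pair $(x_1,\dots,x_n),(y_1,\dots,y_n)\in X^n$ there exists $(z_1,\dots,z_n)\in X^n$ which is comparable to both $(x_1,\dots,x_n)$ and $(y_1,\dots,y_n)$ with respect to $\sqsubseteq_{\iota_n}$. Then $F$ has a unique $\ast$-fixed point.
   Context: Fix an integer $n\ge 2$, put $I_n=\{1,\dots,n\}$, and let $\iota_n=\{A,B\}$ be a fixed partition of $I_n$ into two nonempty disjoint subsets $A,B$. For a binary operation $\ast:I_n\times I_n\to I_n$ write $i_k:=\ast(i,k)$. $\mathcal{U}_{\iota_n}$ is the set of all binary operations $\ast$ on $I_n$ with $\ast(A\times A)\subseteq A$, $\ast(A\times B)\subseteq B$, $\ast(B\times A)\subseteq B$, $\ast(B\times B)\subseteq A$. An ordered metric space $(X,d,\preceq)$ is a nonempty set $X$ with a metric $d$ and a partial order $\preceq$; $x\succeq y$ means $y\preceq x$. On $X^n$, $(x_1,\dots,x_n)\sqsubseteq_{\iota_n}(y_1,\dots,y_n)$ means $x_i\preceq y_i$ for each $i\in A$ and $x_i\succeq y_i$ for each $i\in B$. Two elements of a partially ordered set are comparable if one is less than or equal to the other. A subspace is a nonempty subset with the restricted metric and order. Sequences are indexed by $m\in\mathbb{N}_0=\{0,1,2,\dots\}$. A sequence is increasing (decreasing) if $x^{(m)}\preceq x^{(l)}$ ($x^{(m)}\succeq x^{(l)}$) whenever $m<l$, and monotone if it is increasing or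 decreasing. $x^{(m)}\uparrow x$ (resp. $\downarrow x$, $\uparrow\downarrow x$) means $\{x^{(m)}\}$ is increasing (resp. decreasing, monotone) and converges to $x$ in $d$. An ordered metric space is O-complete if every monotone Cauchy sequence in it converges in it. $F:X^n\to X$ has the $\iota_n$-mixed monotone property if, with all other arguments fixed arbitrarily, $\underline{x}_i\preceq\overline{x}_i$ implies $F(\dots,\underline{x}_i,\dots)\preceq F(\dots,\overline{x}_i,\dots)$ ($i$-th argument) when $i\in A$, and $F(\dots,\underline{x}_i,\dots)\succeq F(\dots,\overline{x}_i,\dots)$ when $i\in B$. $F$ is O-continuous if $x_i^{(m)}\uparrow\downarrow x_i$ for all $i\in I_n$ implies $F(x_1^{(m)},\dots,x_n^{(m)})\to F(x_1,\dots,x_n)$. $(E,d,\preceq)$ has the MCB property if for every sequence $\{x^{(m)}\}$ in $E$ and $x\in E$: $x^{(m)}\uparrow x$ implies $x^{(m)}\preceq x$ for all $m$, and $x^{(m)}\downarrow x$ implies $x^{(m)}\succeq x$ for all $m$. $\Omega$ is the set of functions $\varphi:[0,\infty)\to[0,\infty)$ with $\varphi(t)<t$ and $\limsup_{r\to t^+}\varphi(r)<t$ for every $t>0$. An $\ast$-fixed point of $F$ is $(x_1,\dots,x_n)\in X^n$ with $F(x_{i_1},\dots,x_{i_n})=x_i$ for each $i\in I_n$. *)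

theory Defs
  imports "HOL-Analysis.Analysis"
begin

text \<open>Only the values of \<open>le\<close> on \<open>M\<close> matter, so a subspace of \<open>(M, d, le)\<close> is simply
  \<open>(E, d, le)\<close> for a nonempty \<open>E \<subseteq> M\<close>, with no explicit restriction of \<open>d\<close> and \<open>le\<close>.\<close>

locale ordered_metric_space = Metric_space M d
  for M :: "'a set" and d :: "'a \<Rightarrow> 'a \<Rightarrow> real" +
  fixes le :: "'a \<Rightarrow> 'a \<Rightarrow> bool"
  assumes nonempty: "M \<noteq> {}"
    and le_refl: "reflp_on M le"
    and le_antisym: "antisymp_on M le"
    and le_trans: "transp_on M le"
begin

definition increasing :: "(nat \<Rightarrow> 'a) \<Rightarrow> bool" where
  "increasing s \<longleftrightarrow> (\<forall>m l. m < l \<longrightarrow> le (s m) (s l))"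

definition decreasing :: "(nat \<Rightarrow> 'a) \<Rightarrow> bool" where
  "decreasing s \<longleftrightarrow> (\<forall>m l. m < l \<longrightarrow> le (s l) (s m))"

definition converges :: "(nat \<Rightarrow> 'a) \<Rightarrow> 'a \<Rightarrow> bool" where
  "converges s x \<longleftrightarrow> range s \<subseteq> M \<and> limitin mtopology s x sequentially"

definition converges_up :: "(nat \<Rightarrow> 'a) \<Rightarrow> 'a \<Rightarrow> bool" where
  "converges_up s x \<longleftrightarrow> increasing s \<and> converges s x"

definition converges_down :: "(nat \<Rightarrow> 'a) \<Rightarrow> 'a \<Rightarrow> bool" where
  "converges_down s x \<longleftrightarrow> decreasing s \<and> converges s x"

definition converges_monotone :: "(nat \<Rightarrow> 'a) \<Rightarrow> 'a \<Rightarrow> bool" where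
  "converges_monotone s x \<longleftrightarrow> (increasing s \<or> decreasing s) \<and> converges s x"

definition O_complete :: bool where
  "O_complete \<longleftrightarrow>
     (\<forall>s. (increasing s \<or> decreasing s) \<and> MCauchy s \<longrightarrow> (\<exists>x\<in>M. converges s x))"

definition MCB :: bool where
  "MCB \<longleftrightarrow> (\<forall>s x. range s \<subseteq> M \<and> x \<in> M \<longrightarrow>
     (converges_up s x \<longrightarrow> (\<forall>m. le (s m) x)) \<and>
     (converges_down s x \<longrightarrow> (\<forall>m. le x (s m))))"

end

text \<open>\<open>X\<^sup>n\<close> is modelled by the extensional functions on \<open>{1..n}\<close> with values in \<open>X\<close>.\<close>

definition tuples :: "nat \<Rightarrow> 'a set \<Rightarrow> (nat \<Rightarrow> 'a) set" where
  "tuples n X = ({1..n} \<rightarrow>\<^sub>E X)"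

text \<open>\<open>A\<close> and \<open>B\<close> do not play symmetric roles below, so the partition is given as the ordered
  pair of its blocks.\<close>

definition is_bipartition :: "nat \<Rightarrow> nat set \<Rightarrow> nat set \<Rightarrow> bool" where
  "is_bipartition n A B \<longleftrightarrow> A \<noteq> {} \<and> B \<noteq> {} \<and> A \<inter> B = {} \<and> A \<union> B = {1..n}"

definition admissible_ops :: "nat \<Rightarrow> nat set \<Rightarrow> nat set \<Rightarrow> (nat \<times> nat \<Rightarrow> nat) set" where
  "admissible_ops n A B = {ast \<in> {1..n} \<times> {1..n} \<rightarrow> {1..n}.
     ast ` (A \<times> A) \<subseteq> A \<and> ast ` (A \<times> B) \<subseteq> B \<and> ast ` (B \<times> A) \<subseteq> B \<and> ast ` (B \<times> B) \<subseteq> A}"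

text \<open>The tuple \<open>(x\<^bsub>i\<^sub>1\<^esub>, \<dots>, x\<^bsub>i\<^sub>n\<^esub>)\<close>, where \<open>i\<^sub>k = ast (i, k)\<close>.\<close>

definition reindex :: "nat \<Rightarrow> (nat \<times> nat \<Rightarrow> nat) \<Rightarrow> nat \<Rightarrow> (nat \<Rightarrow> 'a) \<Rightarrow> nat \<Rightarrow> 'a" where
  "reindex n ast i x = (\<lambda>k\<in>{1..n}. x (ast (i, k)))"

definition mixed_le ::
  "('a \<Rightarrow> 'a \<Rightarrow> bool) \<Rightarrow> nat set \<Rightarrow> nat set \<Rightarrow> (nat \<Rightarrow> 'a) \<Rightarrow> (nat \<Rightarrow> 'a) \<Rightarrow> bool" where
  "mixed_le le A B x y \<longleftrightarrow> (\<forall>i\<in>A. le (x i) (y i)) \<and> (\<forall>i\<in>B. le (y i) (x i))"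

definition comparable :: "('b \<Rightarrow> 'b \<Rightarrow> bool) \<Rightarrow> 'b \<Rightarrow> 'b \<Rightarrow> bool" where
  "comparable R x y \<longleftrightarrow> R x y \<or> R y x"

definition mixed_monotone ::
  "nat \<Rightarrow> nat set \<Rightarrow> nat set \<Rightarrow> 'a set \<Rightarrow> ('a \<Rightarrow> 'a \<Rightarrow> bool) \<Rightarrow> ((nat \<Rightarrow> 'a) \<Rightarrow> 'a) \<Rightarrow> bool" where
  "mixed_monotone n A B X le F \<longleftrightarrow>
     (\<forall>x\<in>tuples n X. \<forall>a\<in>X. \<forall>b\<in>X. le a b \<longrightarrow>
        (\<forall>i\<in>A. le (F (x(i := a))) (F (x(i := b)))) \<and>
        (\<forall>i\<in>B. le (F (x(i := b))) (F (x(i := a)))))"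

definition O_continuous ::
  "nat \<Rightarrow> 'a set \<Rightarrow> ('a \<Rightarrow> 'a \<Rightarrow> real) \<Rightarrow> ('a \<Rightarrow> 'a \<Rightarrow> bool) \<Rightarrow> ((nat \<Rightarrow> 'a) \<Rightarrow> 'a) \<Rightarrow> bool" where
  "O_continuous n X d le F \<longleftrightarrow>
     (\<forall>s x. (\<forall>m. s m \<in> tuples n X) \<and> x \<in> tuples n X \<and>
        (\<forall>i\<in>{1..n}. ordered_metric_space.converges_monotone X d le (\<lambda>m. s m i) (x i)) \<longrightarrow>
        ordered_metric_space.converges X d (\<lambda>m. F (s m)) (F x))"

text \<open>Functions on \<open>[0, \<infinity>)\<close> are total functions whose values at negative reals are irrelevant.
  The limit superior is taken in the extended reals.\<close>

definition Omega :: "(real \<Rightarrow> real) set" where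
  "Omega = {\<phi> \<in> {0..} \<rightarrow> {0..}.
     \<forall>t>0. \<phi> t < t \<and> Limsup (at_right t) (\<lambda>r. ereal (\<phi> r)) < ereal t}"

definition ast_fixed_point ::
  "nat \<Rightarrow> (nat \<times> nat \<Rightarrow> nat) \<Rightarrow> 'a set \<Rightarrow> ((nat \<Rightarrow> 'a) \<Rightarrow> 'a) \<Rightarrow> (nat \<Rightarrow> 'a) \<Rightarrow> bool" where
  "ast_fixed_point n ast X F x \<longleftrightarrow>
     x \<in> tuples n X \<and> (\<forall>i\<in>{1..n}. F (reindex n ast i x) = x i)"

end

theory Submission
  imports Defs
begin

text \<open>On \<open>X\<^sup>n\<close> the map \<open>T x = (F(x\<^bsub>1\<^sub>1\<^esub>, \<dots>, x\<^bsub>1\<^sub>n\<^esub>), \<dots>, F(x\<^bsub>n\<^sub>1\<^esub>, \<dots>, x\<^bsub>n\<^sub>n\<^esub>))\<close> has the \<open>ast\<close>-fixed points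
  of \<open>F\<close> as its fixed points, and admissibility of \<open>ast\<close> makes it isotone for the mixed order. Both
  contraction conditions say that \<open>T\<close> is a \<open>\<phi>\<close>-contraction on comparable pairs, for the average or the
  maximum metric on \<open>X\<^sup>n\<close>, and \<open>\<phi> \<in> \<Omega>\<close> enters only through the resulting Meir--Keeler condition: for
  every \<open>t > 0\<close> there is \<open>\<delta> > 0\<close> such that \<open>D x y < t + \<delta>\<close> implies \<open>D (T x) (T y) < t\<close>. It forces orbits
  of comparable points together and makes the orbit of a point comparable to its image Cauchy.\<close>

section \<open>From functions in \<open>Omega\<close> to a Meir-Keeler bound\<close>

text \<open>Beyond \<open>t\<close> the bound comes from the limit superior, up to and including
  \<open>t\<close> from \<open>\<phi> r < r\<close>. The point \<open>r = 0\<close> is left out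
  because \<open>Omega\<close> only makes \<open>\<phi> 0\<close> nonnegative.\<close>

lemma Omega_less_right:
  assumes "\<phi> \<in> Omega" "t > 0"
  shows "\<exists>\<delta>>0. \<forall>r. 0 < r \<and> r < t + \<delta> \<longrightarrow> \<phi> r < t"
proof -
  have less: "\<phi> r < r" if "r > 0" for r
    using assms(1) that by (auto simp: Omega_def)
  have "Limsup (at_right t) (\<lambda>r. ereal (\<phi> r)) < ereal t"
    using assms by (auto simp: Omega_def)
  then have "\<forall>\<^sub>F r in at_right t. ereal (\<phi> r) < ereal t"
    by (rule Limsup_lessD)
  then obtain b where b: "b > t" "\<And>r. t < r \<Longrightarrow> r < b \<Longrightarrow> \<phi> r < t"
    by (auto simp: eventually_at_right_field)
  have "\<phi> r < t" if "0 < r" "r < t + (b - t)" for r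
    using b(2)[of r] less[of r] that by (cases "r > t") auto
  with b(1) show ?thesis
    by (intro exI[of _ "b - t"]) auto
qed

section \<open>Meir-Keeler contractions on comparable pairs of a preordered metric space\<close>

text \<open>Metric and relation are parameters so that the average and the maximum metric, and the
  mixed order and its converse, are all instances.\<close>

locale Meir_Keeler_on_comparable = Metric_space Y D
  for Y :: "'b set" and D :: "'b \<Rightarrow> 'b \<Rightarrow> real" +
  fixes R :: "'b \<Rightarrow> 'b \<Rightarrow> bool" and T :: "'b \<Rightarrow> 'b"
  assumes maps_to: "x \<in> Y \<Longrightarrow> T x \<in> Y"
    and isotone: "x \<in> Y \<Longrightarrow> y \<in> Y \<Longrightarrow> R x y \<Longrightarrow> R (T x) (T y)"
    and R_refl: "reflp_on Y R"
    and R_trans: "transp_on Y R"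
    and Meir_Keeler: "t > 0 \<Longrightarrow>
      \<exists>\<delta>>0. \<forall>x\<in>Y. \<forall>y\<in>Y. comparable R x y \<longrightarrow> D x y < t + \<delta> \<longrightarrow> D (T x) (T y) < t"
begin

lemma funpow_in: "x \<in> Y \<Longrightarrow> (T ^^ m) x \<in> Y"
  by (induction m) (auto simp: maps_to)

lemma funpow_isotone: "x \<in> Y \<Longrightarrow> y \<in> Y \<Longrightarrow> R x y \<Longrightarrow> R ((T ^^ m) x) ((T ^^ m) y)"
  by (induction m) (auto simp: isotone funpow_in)

lemma funpow_comparable:
  "x \<in> Y \<Longrightarrow> y \<in> Y \<Longrightarrow> comparable R x y \<Longrightarrow> comparable R ((T ^^ m) x) ((T ^^ m) y)"
  by (auto simp: comparable_def intro: funpow_isotone)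

text \<open>Otherwise \<open>t = D (T x) (T y)\<close> is positive and \<open>D x y < t\<close>, so
  the Meir-Keeler condition at \<open>t\<close> would give \<open>t < t\<close>.\<close>

lemma nonexpansive:
  assumes "x \<in> Y" "y \<in> Y" "comparable R x y"
  shows "D (T x) (T y) \<le> D x y"
proof (rule ccontr)
  assume less: "\<not> ?thesis"
  then have "D (T x) (T y) > 0"
    using nonneg[of x y] by linarith
  from Meir_Keeler[OF this] assms less show False
    by (metis add_strict_increasing less_irrefl linorder_not_le less_eq_real_def add.commute)
qed

text \<open>The distances decrease to some \<open>L\<close>. If \<open>L > 0\<close>, one of them is
  below \<open>L + \<delta>\<close>, so the next falls below \<open>L\<close>, although the limit of
  a decreasing sequence is a lower bound of it.\<close>

lemma orbits_tendsto:
  assumes "x \<in> Y" "y \<in> Y" "comparable R x y"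
  shows "(\<lambda>m. D ((T ^^ m) x) ((T ^^ m) y)) \<longlonglongrightarrow> 0"
proof -
  define a where "a = (\<lambda>m. D ((T ^^ m) x) ((T ^^ m) y))"
  have dec: "decseq a"
    unfolding decseq_Suc_iff a_def
    using assms by (auto intro!: nonexpansive funpow_in funpow_comparable)
  obtain L where L: "a \<longlonglongrightarrow> L" "\<And>m. L \<le> a m"
    using decseq_convergent[OF dec, of 0] by (auto simp: a_def)
  have "L \<ge> 0"
    using L(1) by (rule LIMSEQ_le_const) (auto simp: a_def)
  moreover have "\<not> L > 0"
  proof
    assume "L > 0"
    from Meir_Keeler[OF this] obtain \<delta> where \<delta>: "\<delta> > 0"
      "\<And>u v. u \<in> Y \<Longrightarrow> v \<in> Y \<Longrightarrow> comparable R u v \<Longrightarrow> D u v < L + \<delta> \<Longrightarrow> D (T u) (T v) < L"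
      by blast
    have "\<forall>\<^sub>F m in sequentially. a m < L + \<delta>"
      using L(1) \<delta>(1) by (intro order_tendstoD) auto
    then obtain m where "a m < L + \<delta>"
      by (auto simp: eventually_sequentially)
    then have "a (Suc m) < L"
      using \<delta>(2) assms by (auto simp: a_def funpow_in funpow_comparable)
    with L(2)[of "Suc m"] show False by simp
  qed
  ultimately show ?thesis
    using L(1) by (simp add: a_def)
qed

text \<open>A fixed point is its own orbit, so the orbit of \<open>z\<close> approaches both
  \<open>x\<close> and \<open>y\<close>.\<close>

lemma fixed_point_unique:
  assumes "x \<in> Y" "T x = x" "y \<in> Y" "T y = y"
    and z: "z \<in> Y" "comparable R z x" "comparable R z y"
  shows "x = y"
proof -
  have fixed: "(T ^^ m) x = x" "(T ^^ m) y = y" for m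
    using assms(2,4) by (induction m) auto
  have "(\<lambda>m. D ((T ^^ m) z) x + D ((T ^^ m) z) y) \<longlonglongrightarrow> 0 + 0"
    using orbits_tendsto[of z x] orbits_tendsto[of z y] assms
    by (intro tendsto_add) (auto simp: fixed)
  moreover have "D x y \<le> D ((T ^^ m) z) x + D ((T ^^ m) z) y" for m
    using assms by (metis commute triangle funpow_in)
  ultimately have "D x y \<le> 0 + 0"
    by (intro LIMSEQ_le_const) auto
  then show ?thesis
    using assms(1,3) nonneg[of x y] by (simp add: zero)
qed

lemma orbit_le:
  assumes "x \<in> Y" "R x (T x)"
  shows "m \<le> l \<Longrightarrow> R ((T ^^ m) x) ((T ^^ l) x)"
proof (induction l rule: dec_induct)
  case base
  then show ?case
    using R_refl assms(1) by (auto intro: reflp_onD funpow_in)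
next
  case (step l)
  have "R ((T ^^ l) x) ((T ^^ Suc l) x)"
    using funpow_isotone[of x "T x" l] assms by (simp add: maps_to funpow_swap1)
  with step(3) show ?case
    using R_trans assms(1) by (blast intro: transp_onD funpow_in)
qed

text \<open>Once consecutive points are closer than \<open>\<delta>\<close>, the orbit cannot leave
  the ball of radius \<open>t + \<delta>\<close> around \<open>?s m\<close>: \<open>T\<close> takes
  a later orbit point of this ball to within \<open>t\<close> of \<open>?s (Suc m)\<close>, which is
  within \<open>\<delta>\<close> of the centre. Comparability holds because the orbit is a
  chain.\<close>

lemma orbit_MCauchy:
  assumes "x \<in> Y" "R x (T x)"
  shows "MCauchy (\<lambda>m. (T ^^ m) x)"
proof -
  let ?s = "\<lambda>m. (T ^^ m) x"
  have close: "\<exists>N. \<forall>m\<ge>N. \<forall>k. D (?s m) (?s (m + k)) < \<epsilon>" if "\<epsilon> > 0" for \<epsilon>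
  proof -
    define t where "t = \<epsilon> / 2"
    have t: "t > 0" using that by (simp add: t_def)
    from Meir_Keeler[OF this] obtain \<delta>' where \<delta>': "\<delta>' > 0"
      "\<And>u v. u \<in> Y \<Longrightarrow> v \<in> Y \<Longrightarrow> comparable R u v \<Longrightarrow> D u v < t + \<delta>' \<Longrightarrow> D (T u) (T v) < t"
      by blast
    \<comment> \<open>Being at most \<open>\<delta>'\<close> makes the Meir-Keeler condition
      applicable; being at most \<open>t\<close> makes the final radius \<open>t + \<delta>\<close>
      at most \<open>\<epsilon>\<close>.\<close>
    define \<delta> where "\<delta> = min t \<delta>'"
    have \<delta>: "\<delta> > 0" "\<delta> \<le> t" "\<delta> \<le> \<delta>'"
      using t \<delta>'(1) by (auto simp: \<delta>_def)
    \<comment> \<open>The orbit of \<open>T x\<close> is the orbit of \<open>x\<close> shifted by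
      one, so consecutive distances tend to 0.\<close>
    have "(\<lambda>m. D (?s m) ((T ^^ m) (T x))) \<longlonglongrightarrow> 0"
      using assms by (intro orbits_tendsto) (auto simp: maps_to comparable_def)
    then have "\<forall>\<^sub>F m in sequentially. D (?s m) (?s (Suc m)) < \<delta>"
      using \<delta>(1) by (intro order_tendstoD) (auto simp: funpow_swap1)
    then obtain N where N: "\<And>m. m \<ge> N \<Longrightarrow> D (?s m) (?s (Suc m)) < \<delta>"
      by (auto simp: eventually_sequentially)
    have "D (?s m) (?s (m + k)) < t + \<delta>" if "m \<ge> N" for m k
    proof (induction k)
      case 0
      then show ?case using t \<delta>(1) assms(1) by (simp add: funpow_in)
    next
      case (Suc k)
      have "comparable R (?s m) (?s (m + k))"
        using orbit_le[OF assms, of m "m + k"] by (simp add: comparable_def)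
      then have "D (?s (Suc m)) (?s (Suc (m + k))) < t"
        using \<delta>'(2)[of "?s m" "?s (m + k)"] Suc \<delta>(3) assms(1) by (auto simp: funpow_in)
      moreover have "D (?s m) (?s (Suc (m + k)))
          \<le> D (?s m) (?s (Suc m)) + D (?s (Suc m)) (?s (Suc (m + k)))"
        using assms(1) by (intro triangle funpow_in)
      ultimately show ?case
        using N[OF that] by simp
    qed
    moreover have "t + \<delta> \<le> \<epsilon>"
      using \<delta>(2) by (simp add: t_def)
    ultimately show ?thesis
      by (meson less_le_trans)
  qed
  show ?thesis
    unfolding MCauchy_def
  proof (intro conjI allI impI)
    show "range ?s \<subseteq> Y"
      using assms(1) by (auto intro: funpow_in)
    fix \<epsilon> :: real
    assume "\<epsilon> > 0"
    then obtain N where N: "\<And>m k. m \<ge> N \<Longrightarrow> D (?s m) (?s (m + k)) < \<epsilon>"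
      using close by meson
    have "D (?s m) (?s l) < \<epsilon>" if "N \<le> m" "N \<le> l" for m l
      using N[of m "l - m"] N[of l "m - l"] that commute[of "?s m" "?s l"]
      by (cases "m \<le> l") auto
    then show "\<exists>N. \<forall>m l. N \<le> m \<longrightarrow> N \<le> l \<longrightarrow> D (?s m) (?s l) < \<epsilon>"
      by blast
  qed
qed

end

section \<open>The induced map on tuples and the mixed order\<close>

text \<open>The restriction makes the result extensional, so that being a fixed point is plain
  equality of functions.\<close>

definition tuple_map ::
  "nat \<Rightarrow> (nat \<times> nat \<Rightarrow> nat) \<Rightarrow> ((nat \<Rightarrow> 'a) \<Rightarrow> 'a) \<Rightarrow> (nat \<Rightarrow> 'a) \<Rightarrow> nat \<Rightarrow> 'a" where
  "tuple_map n ast F x = (\<lambda>i\<in>{1..n}. F (reindex n ast i x))"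

lemma tuple_map_apply: "i \<in> {1..n} \<Longrightarrow> tuple_map n ast F x i = F (reindex n ast i x)"
  by (simp add: tuple_map_def)

lemma ast_fixed_point_iff:
  "ast_fixed_point n ast X F x \<longleftrightarrow> x \<in> tuples n X \<and> tuple_map n ast F x = x"
  unfolding ast_fixed_point_def tuple_map_def tuples_def
  by (auto simp: fun_eq_iff restrict_def PiE_def extensional_def)

lemma reindex_in_tuples:
  assumes "ast \<in> {1..n} \<times> {1..n} \<rightarrow> {1..n}" "x \<in> tuples n X" "i \<in> {1..n}"
  shows "reindex n ast i x \<in> tuples n X"
  using assms by (fastforce simp: reindex_def tuples_def PiE_def Pi_def)

lemma tuple_map_in_tuples:
  assumes "ast \<in> {1..n} \<times> {1..n} \<rightarrow> {1..n}" "F ` tuples n X \<subseteq> E" "x \<in> tuples n X"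
  shows "tuple_map n ast F x \<in> tuples n E"
  using assms reindex_in_tuples[OF assms(1,3)]
  by (auto simp: tuple_map_def tuples_def[of n E])

text \<open>Exchanging the blocks reverses the order; this reduces the second alternative of (iii)
  to the first.\<close>

lemma mixed_le_swap: "mixed_le le B A x y \<longleftrightarrow> mixed_le le A B y x"
  by (auto simp: mixed_le_def)

lemma tuples_nth: "x \<in> tuples n X \<Longrightarrow> i \<in> {1..n} \<Longrightarrow> x i \<in> X"
  by (auto simp: tuples_def)

lemma mixed_le_refl:
  assumes "A \<union> B = {1..n}" "reflp_on X le"
  shows "reflp_on (tuples n X) (mixed_le le A B)"
proof (rule reflp_onI)
  fix x assume "x \<in> tuples n X"
  then show "mixed_le le A B x x"
    using assms tuples_nth[of x n X] unfolding mixed_le_def by (metis UnI1 UnI2 reflp_onD)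
qed

lemma mixed_le_trans:
  assumes "A \<union> B = {1..n}" "transp_on X le"
  shows "transp_on (tuples n X) (mixed_le le A B)"
proof (rule transp_onI)
  fix x y z
  assume "x \<in> tuples n X" "y \<in> tuples n X" "z \<in> tuples n X"
    and "mixed_le le A B x y" "mixed_le le A B y z"
  moreover have "i \<in> {1..n}" if "i \<in> A \<or> i \<in> B" for i
    using assms(1) that by blast
  ultimately show "mixed_le le A B x z"
    using assms(2) tuples_nth[of x n X] tuples_nth[of y n X] tuples_nth[of z n X]
    unfolding mixed_le_def by (meson transp_onD)
qed

text \<open>Passing from \<open>x\<close> to \<open>y\<close> one coordinate at a time.\<close>

lemma mixed_monotone_le:
  assumes AB: "A \<union> B = {1..n}" and le: "reflp_on X le" "transp_on X le"
    and F: "F \<in> tuples n X \<rightarrow> X" and mono: "mixed_monotone n A B X le F"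
    and x: "x \<in> tuples n X" and y: "y \<in> tuples n X" and xy: "mixed_le le A B x y"
  shows "le (F x) (F y)"
proof -
  have fin: "finite {1..n}" by simp
  have mem: "override_on x y S \<in> tuples n X" for S
    using x y by (auto simp: override_on_def tuples_def PiE_iff extensional_def)
  have "le (F x) (F (override_on x y S))" if "S \<subseteq> {1..n}" for S
    using finite_subset[OF that fin] that
  proof (induction S)
    case empty
    then show ?case using le(1) F x by (auto intro: reflp_onD)
  next
    case (insert i S)
    let ?z = "override_on x y S"
    have i: "i \<in> {1..n}" "x i \<in> X" "y i \<in> X"
      using insert x y tuples_nth[of _ n X] by auto
    \<comment> \<open>As \<open>i\<close> is not in \<open>S\<close>, both tuples are updates at
      \<open>i\<close> of the same tuple, the form in which \<open>mixed_monotone\<close>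
      applies.\<close>
    have z: "?z = ?z(i := x i)" "override_on x y (insert i S) = ?z(i := y i)"
      using insert by (auto simp: override_on_def)
    have "le (F (?z(i := x i))) (F (?z(i := y i)))"
    proof (cases "i \<in> A")
      case True
      then show ?thesis
        using mono mem[of S] i xy unfolding mixed_monotone_def mixed_le_def by blast
    next
      case False
      then have "i \<in> B" using i AB by blast
      then show ?thesis
        using mono mem[of S] i xy unfolding mixed_monotone_def mixed_le_def by blast
    qed
    then have "le (F ?z) (F (override_on x y (insert i S)))"
      using z by metis
    moreover have "le (F x) (F ?z)"
      using insert by auto
    ultimately show ?case
      using le(2) F x mem by (metis funcset_mem transp_onD)
  qed
  \<comment> \<open>Off \<open>{1..n}\<close> the overriding keeps the value of \<open>x\<close>,
    which agrees with \<open>y\<close> there since both are extensional.\<close>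
  moreover have "override_on x y {1..n} = y"
    using x y by (auto simp: override_on_def tuples_def PiE_def extensional_def fun_eq_iff)
  ultimately show ?thesis
    by force
qed

text \<open>For \<open>i\<close> in \<open>A\<close>, the map \<open>k \<mapsto> ast (i, k)\<close>
  preserves the blocks, so reindexing keeps the mixed order; for \<open>i\<close> in
  \<open>B\<close> it exchanges them, so reindexing reverses it. Since \<open>F\<close> is isotone
  for the mixed order, each component moves in the direction its block prescribes.\<close>

lemma tuple_map_isotone:
  assumes AB: "A \<union> B = {1..n}" and le: "reflp_on X le" "transp_on X le"
    and F: "F \<in> tuples n X \<rightarrow> X" and mono: "mixed_monotone n A B X le F"
    and ast: "ast \<in> admissible_ops n A B"
    and x: "x \<in> tuples n X" and y: "y \<in> tuples n X" and xy: "mixed_le le A B x y"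
  shows "mixed_le le A B (tuple_map n ast F x) (tuple_map n ast F y)"
proof -
  have sub: "i \<in> {1..n}" if "i \<in> A \<or> i \<in> B" for i
    using AB that by blast
  have maps: "ast \<in> {1..n} \<times> {1..n} \<rightarrow> {1..n}"
    and AA: "\<And>i k. i \<in> A \<Longrightarrow> k \<in> A \<Longrightarrow> ast (i, k) \<in> A"
    and AB': "\<And>i k. i \<in> A \<Longrightarrow> k \<in> B \<Longrightarrow> ast (i, k) \<in> B"
    and BA: "\<And>i k. i \<in> B \<Longrightarrow> k \<in> A \<Longrightarrow> ast (i, k) \<in> B"
    and BB: "\<And>i k. i \<in> B \<Longrightarrow> k \<in> B \<Longrightarrow> ast (i, k) \<in> A"
    using ast by (auto simp: admissible_ops_def image_subset_iff)
  have "mixed_le le A B (reindex n ast i x) (reindex n ast i y)" if "i \<in> A" for i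
    using xy that AA AB' sub by (auto simp: mixed_le_def reindex_def)
  moreover have "mixed_le le A B (reindex n ast i y) (reindex n ast i x)" if "i \<in> B" for i
    using xy that BA BB sub by (auto simp: mixed_le_def reindex_def)
  ultimately show ?thesis
    using mixed_monotone_le[OF AB le F mono] reindex_in_tuples[OF maps] x y sub
    unfolding mixed_le_def[of le A B "tuple_map n ast F x"] by (metis tuple_map_apply)
qed

section \<open>Metrics on the tuple space\<close>

text \<open>The two bounds say that convergence in \<open>D\<close> is coordinatewise convergence.\<close>

locale tuple_metric = Metric_space X d
  for n :: nat and X :: "'a set" and d :: "'a \<Rightarrow> 'a \<Rightarrow> real" +
  fixes D :: "(nat \<Rightarrow> 'a) \<Rightarrow> (nat \<Rightarrow> 'a) \<Rightarrow> real"
  assumes D_commute: "D x y = D y x"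
    and D_triangle: "x \<in> tuples n X \<Longrightarrow> y \<in> tuples n X \<Longrightarrow> z \<in> tuples n X \<Longrightarrow> D x z \<le> D x y + D y z"
    and D_lower: "i \<in> {1..n} \<Longrightarrow> d (x i) (y i) \<le> real n * D x y"
    and D_upper: "D x y \<le> (\<Sum>i=1..n. d (x i) (y i))"
    and n_pos: "n > 0"
begin

lemma D_nonneg: "0 \<le> D x y"
proof -
  have "0 \<le> d (x 1) (y 1)" by simp
  also have "\<dots> \<le> real n * D x y"
    using n_pos by (intro D_lower) auto
  finally show ?thesis
    using n_pos by (simp add: zero_le_mult_iff)
qed

lemma Metric_space_tuples: "Metric_space (tuples n X) D"
proof
  fix x y
  assume x: "x \<in> tuples n X" and y: "y \<in> tuples n X"
  show "D x y = 0 \<longleftrightarrow> x = y"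
  proof
    assume "D x y = 0"
    then have "d (x i) (y i) = 0" if "i \<in> {1..n}" for i
      using D_lower[OF that, of x y] nonneg[of "x i" "y i"] by simp
    then have "x i = y i" if "i \<in> {1..n}" for i
      using that x y tuples_nth[of _ n X] by (metis zero)
    then show "x = y"
      using x y unfolding tuples_def by (intro PiE_ext)
  next
    assume "x = y"
    moreover have "d (x i) (x i) = 0" if "i \<in> {1..n}" for i
      using x that tuples_nth[of x n X] by simp
    ultimately show "D x y = 0"
      using D_upper[of x y] D_nonneg[of x y] by simp
  qed
qed (use D_commute D_triangle D_nonneg in auto)

end

text \<open>The average dictates the factor \<open>real n\<close> in \<open>D_lower\<close>: undoing
  the division leaves the sum, which dominates each of its terms.\<close>

lemma tuple_metric_average:
  assumes "Metric_space X d" "n > 0"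
  shows "tuple_metric n X d (\<lambda>x y. (1 / real n) * (\<Sum>i=1..n. d (x i) (y i)))"
proof -
  interpret Metric_space X d by fact
  have nonneg: "(\<Sum>i=1..n. d (x i) (y i)) \<ge> 0" for x y
    by (intro sum_nonneg) auto
  show ?thesis
  proof
    fix x y i
    show "(1 / real n) * (\<Sum>i=1..n. d (x i) (y i)) = (1 / real n) * (\<Sum>i=1..n. d (y i) (x i))"
      by (simp add: commute)
    show "(1 / real n) * (\<Sum>i=1..n. d (x i) (y i)) \<le> (\<Sum>i=1..n. d (x i) (y i))"
      using nonneg[of x y] assms(2) by (intro mult_left_le_one_le) auto
    assume "i \<in> {1..n}"
    then have "d (x i) (y i) \<le> (\<Sum>i=1..n. d (x i) (y i))"
      by (intro member_le_sum) auto
    then show "d (x i) (y i) \<le> real n * ((1 / real n) * (\<Sum>i=1..n. d (x i) (y i)))"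
      using assms(2) by simp
  next
    fix x y z
    assume xyz: "x \<in> tuples n X" "y \<in> tuples n X" "z \<in> tuples n X"
    have "(\<Sum>i=1..n. d (x i) (z i)) \<le> (\<Sum>i=1..n. d (x i) (y i) + d (y i) (z i))"
      using xyz by (intro sum_mono triangle tuples_nth[of _ n X])
    then show "(1 / real n) * (\<Sum>i=1..n. d (x i) (z i)) \<le>
        (1 / real n) * (\<Sum>i=1..n. d (x i) (y i)) + (1 / real n) * (\<Sum>i=1..n. d (y i) (z i))"
      by (simp add: sum.distrib add_divide_distrib[symmetric] divide_right_mono)
  qed (rule assms(2))
qed

lemma tuple_metric_Max:
  assumes "Metric_space X d" "n > 0"
  shows "tuple_metric n X d (\<lambda>x y. Max ((\<lambda>i. d (x i) (y i)) ` {1..n}))"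
proof -
  interpret Metric_space X d by fact
  have ge: "d (x i) (y i) \<le> Max ((\<lambda>i. d (x i) (y i)) ` {1..n})" if "i \<in> {1..n}" for x y i
    using that by (intro Max_ge) auto
  have ne: "(\<lambda>i. d (x i) (y i)) ` {1..n} \<noteq> {}" for x y
    using assms(2) by auto
  show ?thesis
  proof
    fix x y i
    show "Max ((\<lambda>i. d (x i) (y i)) ` {1..n}) = Max ((\<lambda>i. d (y i) (x i)) ` {1..n})"
      by (simp add: commute)
    show "Max ((\<lambda>i. d (x i) (y i)) ` {1..n}) \<le> (\<Sum>i=1..n. d (x i) (y i))"
      using ne by (intro Max.boundedI) (auto intro!: member_le_sum)
    assume i: "i \<in> {1..n}"
    \<comment> \<open>The maximum bounds each coordinate with factor 1, which is weakened to the
      \<open>real n\<close> of \<open>D_lower\<close>.\<close>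
    have "1 * d (x i) (y i) \<le> real n * Max ((\<lambda>i. d (x i) (y i)) ` {1..n})"
      using assms(2) ge[OF i, of x y] by (intro mult_mono) auto
    then show "d (x i) (y i) \<le> real n * Max ((\<lambda>i. d (x i) (y i)) ` {1..n})"
      by simp
  next
    fix x y z
    assume xyz: "x \<in> tuples n X" "y \<in> tuples n X" "z \<in> tuples n X"
    have "d (x i) (z i) \<le>
        Max ((\<lambda>i. d (x i) (y i)) ` {1..n}) + Max ((\<lambda>i. d (y i) (z i)) ` {1..n})"
      if "i \<in> {1..n}" for i
      using triangle[OF xyz[THEN tuples_nth[OF _ that]]] ge[OF that, of x y] ge[OF that, of y z]
      by linarith
    then show "Max ((\<lambda>i. d (x i) (z i)) ` {1..n}) \<le>
        Max ((\<lambda>i. d (x i) (y i)) ` {1..n}) + Max ((\<lambda>i. d (y i) (z i)) ` {1..n})"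
      using ne by (intro Max.boundedI) auto
  qed (rule assms(2))
qed

section \<open>Convergence in subspaces and existence of a fixed point\<close>

lemma ordered_metric_space_subspace:
  assumes "ordered_metric_space X d le" "E \<noteq> {}" "E \<subseteq> X"
  shows "ordered_metric_space E d le"
proof -
  interpret ordered_metric_space X d le by fact
  interpret E: Metric_space E d
    using assms(3) by (rule subspace)
  show ?thesis
    by standard (use assms le_refl le_antisym le_trans in
      \<open>auto intro: reflp_on_subset antisymp_on_subset transp_on_subset\<close>)
qed

lemma limitin_iff_dist_tendsto:
  assumes "Metric_space M d" "range s \<subseteq> M"
  shows "limitin (Metric_space.mtopology M d) s x sequentially \<longleftrightarrow>
    x \<in> M \<and> (\<lambda>m. d (s m) x) \<longlonglongrightarrow> 0"
proof -
  interpret Metric_space M d by fact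
  show ?thesis
    using assms(2) by (auto simp: limitin_metric tendsto_iff image_subset_iff)
qed

text \<open>In terms of distances, convergence in \<open>E\<close> and in \<open>X\<close> differ
  only by membership, so limits found in \<open>E\<close> can be fed to \<open>F\<close> on
  \<open>X\<close>.\<close>

lemma converges_iff_dist_tendsto:
  assumes "ordered_metric_space M d le"
  shows "ordered_metric_space.converges M d s x \<longleftrightarrow>
    range s \<subseteq> M \<and> x \<in> M \<and> (\<lambda>m. d (s m) x) \<longlonglongrightarrow> 0"
proof -
  interpret ordered_metric_space M d le by fact
  show ?thesis
    using limitin_iff_dist_tendsto[OF Metric_space_axioms] by (auto simp: converges_def)
qed

text \<open>The orbit of \<open>u\<close> is Cauchy with monotone coordinates, so it converges
  coordinatewise in \<open>E\<close>; either case of \<open>ii\<close> carries the limit through the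
  map. The blocks enter symmetrically enough that the lemma also applies with \<open>A\<close> and
  \<open>B\<close> exchanged, that is, to the reversed order.\<close>

lemma ex_ast_fixed_point:
  assumes AB: "A \<union> B = {1..n}"
    and space: "ordered_metric_space X d le"
    and ast: "ast \<in> {1..n} \<times> {1..n} \<rightarrow> {1..n}"
    and E: "E \<noteq> {}" "E \<subseteq> X"
    and complete: "ordered_metric_space.O_complete E d le"
    and range: "F ` tuples n X \<subseteq> E"
    and ii: "O_continuous n X d le F \<or> ordered_metric_space.MCB E d le"
    and D: "tuple_metric n X d D"
    and contr: "Meir_Keeler_on_comparable (tuples n X) D (mixed_le le A B) (tuple_map n ast F)"
    and u: "u \<in> tuples n X" "mixed_le le A B u (tuple_map n ast F u)"
  shows "\<exists>x. ast_fixed_point n ast X F x"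
proof -
  interpret X: ordered_metric_space X d le by fact
  interpret E: ordered_metric_space E d le
    using space E by (rule ordered_metric_space_subspace)
  interpret D: tuple_metric n X d D by fact
  let ?T = "tuple_map n ast F"
  interpret T: Meir_Keeler_on_comparable "tuples n X" D "mixed_le le A B" ?T by fact
  \<comment> \<open>The sequence starts at \<open>?T u\<close>: the coordinates of \<open>u\<close>
    may lie outside \<open>E\<close>, while completeness and \<open>MCB\<close> concern sequences in
    \<open>E\<close>.\<close>
  define s where "s = (\<lambda>m. (?T ^^ Suc m) u)"
  have sX: "s m \<in> tuples n X" for m
    unfolding s_def using u(1) by (rule T.funpow_in)
  have sE: "s m i \<in> E" if "i \<in> {1..n}" for m i
    using tuple_map_in_tuples[OF ast range T.funpow_in[OF u(1), of m]] tuples_nth that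
    by (auto simp: s_def)
  have s_le: "mixed_le le A B (s m) (s l)" if "m \<le> l" for m l
    using T.orbit_le[OF u, of "Suc m" "Suc l"] that by (simp add: s_def del: funpow.simps)
  have sub: "i \<in> {1..n}" if "i \<in> A \<or> i \<in> B" for i
    using AB that by blast
  have inc: "E.increasing (\<lambda>m. s m i)" if "i \<in> A" for i
    using s_le that by (auto simp: E.increasing_def mixed_le_def)
  have dec: "E.decreasing (\<lambda>m. s m i)" if "i \<in> B" for i
    using s_le that by (auto simp: E.decreasing_def mixed_le_def)
  have "\<exists>x\<in>E. E.converges (\<lambda>m. s m i) x" if i: "i \<in> {1..n}" for i
  proof -
    have "E.MCauchy (\<lambda>m. s m i)"
      unfolding E.MCauchy_def
    proof (intro conjI allI impI)
      show "range (\<lambda>m. s m i) \<subseteq> E"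
        using sE i by auto
      fix \<epsilon> :: real
      assume "\<epsilon> > 0"
      \<comment> \<open>The division compensates the factor in \<open>D_lower\<close>.\<close>
      then have "\<epsilon> / real n > 0"
        using D.n_pos by simp
      with T.orbit_MCauchy[OF u] obtain N where
        N: "\<And>m l. N \<le> m \<Longrightarrow> N \<le> l \<Longrightarrow> D ((?T ^^ m) u) ((?T ^^ l) u) < \<epsilon> / real n"
        unfolding T.MCauchy_def by meson
      have "d (s m i) (s l i) < \<epsilon>" if "N \<le> m" "N \<le> l" for m l
      proof -
        have "D (s m) (s l) < \<epsilon> / real n"
          unfolding s_def using that by (intro N) auto
        then have "real n * D (s m) (s l) < \<epsilon>"
          using D.n_pos by (simp add: field_simps)
        with D.D_lower[OF i, of "s m" "s l"] show ?thesis by simp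
      qed
      then show "\<exists>N. \<forall>m l. N \<le> m \<longrightarrow> N \<le> l \<longrightarrow> d (s m i) (s l i) < \<epsilon>"
        by blast
    qed
    then show ?thesis
      using complete inc dec i AB unfolding E.O_complete_def by blast
  qed
  then obtain x' where x': "\<And>i. i \<in> {1..n} \<Longrightarrow> E.converges (\<lambda>m. s m i) (x' i)"
    by metis
  define x where "x = restrict x' {1..n}"
  have conv: "E.converges (\<lambda>m. s m i) (x i)" if "i \<in> {1..n}" for i
    using x' that by (simp add: x_def)
  have xE: "x i \<in> E" and lim: "(\<lambda>m. d (s m i) (x i)) \<longlonglongrightarrow> 0" if "i \<in> {1..n}" for i
    using conv[OF that] by (auto simp: converges_iff_dist_tendsto[OF E.ordered_metric_space_axioms])
  have x: "x \<in> tuples n X"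
    using xE E(2) by (auto simp: tuples_def x_def)
  have lim_F: "(\<lambda>m. d (?T (s m) i) (?T x i)) \<longlonglongrightarrow> 0" if i: "i \<in> {1..n}" for i
    using ii
  proof
    assume cont: "O_continuous n X d le F"
    let ?y = "\<lambda>m. reindex n ast i (s m)"
    have "X.converges_monotone (\<lambda>m. ?y m k) (reindex n ast i x k)" if k: "k \<in> {1..n}" for k
    proof -
      \<comment> \<open>Each reindexed coordinate sequence is a coordinate sequence of
        \<open>s\<close>, monotone in the direction given by the block of
        \<open>ast (i, k)\<close>.\<close>
      have j: "ast (i, k) \<in> {1..n}"
        using ast i k by auto
      then have "X.converges (\<lambda>m. s m (ast (i, k))) (x (ast (i, k)))"
        using lim sX x tuples_nth[of _ n X]
        by (auto simp: converges_iff_dist_tendsto[OF space])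
      moreover have "ast (i, k) \<in> A \<or> ast (i, k) \<in> B"
        using j AB by blast
      ultimately show ?thesis
        using k inc dec by (auto simp: reindex_def X.converges_monotone_def)
    qed
    moreover have "\<And>m. ?y m \<in> tuples n X" "reindex n ast i x \<in> tuples n X"
      using reindex_in_tuples[OF ast _ i] sX x by blast+
    ultimately have "X.converges (\<lambda>m. F (?y m)) (F (reindex n ast i x))"
      using cont[unfolded O_continuous_def, rule_format, of ?y "reindex n ast i x"] by simp
    then show ?thesis
      using i by (simp add: converges_iff_dist_tendsto[OF space] tuple_map_apply)
  next
    assume MCB: E.MCB
    have ran: "range (\<lambda>m. s m i) \<subseteq> E" if "i \<in> {1..n}" for i
      using sE that by auto
    \<comment> \<open>\<open>MCB\<close> places the limit above the increasing and below the
      decreasing coordinates, so \<open>s m\<close> is below \<open>x\<close> in the mixed order and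
      \<open>nonexpansive\<close> applies.\<close>
    have "le (s m i) (x i)" if "i \<in> A" for m i
      using MCB inc[OF that] conv ran xE sub that
      unfolding E.MCB_def E.converges_up_def by metis
    moreover have "le (x i) (s m i)" if "i \<in> B" for m i
      using MCB dec[OF that] conv ran xE sub that
      unfolding E.MCB_def E.converges_down_def by metis
    ultimately have comp: "comparable (mixed_le le A B) (s m) x" for m
      by (simp add: comparable_def mixed_le_def)
    have bound: "d (?T (s m) i) (?T x i) \<le> real n * (\<Sum>i=1..n. d (s m i) (x i))" for m
    proof -
      have "d (?T (s m) i) (?T x i) \<le> real n * D (?T (s m)) (?T x)"
        using i by (rule D.D_lower)
      also have "\<dots> \<le> real n * (\<Sum>i=1..n. d (s m i) (x i))"
        using T.nonexpansive[OF sX x comp, of m] D.D_upper[of "s m" x]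
        by (intro mult_left_mono) auto
      finally show ?thesis .
    qed
    have "(\<lambda>m. real n * (\<Sum>i=1..n. d (s m i) (x i))) \<longlonglongrightarrow> real n * (\<Sum>i=1..n. 0)"
      using lim by (intro tendsto_intros)
    then have lim0: "(\<lambda>m. real n * (\<Sum>i=1..n. d (s m i) (x i))) \<longlonglongrightarrow> 0"
      by simp
    show ?thesis
      by (rule tendsto_sandwich[OF _ _ tendsto_const lim0])
        (intro always_eventually allI X.nonneg bound)+
  qed
  have "?T x i = x i" if i: "i \<in> {1..n}" for i
  proof -
    have TX: "?T x \<in> tuples n X"
      using x by (rule T.maps_to)
    \<comment> \<open>\<open>?T (s m)\<close> is \<open>s (Suc m)\<close>, so one sequence has both
      \<open>?T x i\<close> and \<open>x i\<close> as limits.\<close>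
    have "(\<lambda>m. d (s (Suc m) i) (?T x i) + d (s (Suc m) i) (x i)) \<longlonglongrightarrow> 0 + 0"
      using lim_F[OF i] LIMSEQ_Suc[OF lim[OF i]] by (intro tendsto_add) (auto simp: s_def)
    moreover have "d (?T x i) (x i) \<le> d (s (Suc m) i) (?T x i) + d (s (Suc m) i) (x i)" for m
      using X.triangle[of "?T x i" "s (Suc m) i" "x i"] X.commute[of "?T x i"]
        tuples_nth[OF TX i] tuples_nth[OF x i] tuples_nth[OF sX i] by simp
    ultimately have "d (?T x i) (x i) \<le> 0 + 0"
      by (intro LIMSEQ_le_const) auto
    then show ?thesis
      using X.nonneg[of "?T x i" "x i"] tuples_nth[OF TX i] tuples_nth[OF x i]
      by (simp add: X.zero)
  qed
  then show ?thesis
    using x by (auto simp: ast_fixed_point_def tuple_map_apply)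
qed

section \<open>Existence and uniqueness of the fixed point\<close>

theorem theorem9:
  fixes n :: nat and A B :: "nat set" and ast :: "nat \<times> nat \<Rightarrow> nat"
    and X E :: "'a set" and d :: "'a \<Rightarrow> 'a \<Rightarrow> real" and le :: "'a \<Rightarrow> 'a \<Rightarrow> bool"
    and F :: "(nat \<Rightarrow> 'a) \<Rightarrow> 'a"
  assumes n: "n \<ge> 2"
    and partition: "is_bipartition n A B"
    and space: "ordered_metric_space X d le"
    and F: "F \<in> tuples n X \<rightarrow> X"
    and ast: "ast \<in> admissible_ops n A B"
    and subspace: "E \<noteq> {}" "E \<subseteq> X"
    and complete: "ordered_metric_space.O_complete E d le"
    and range: "F ` tuples n X \<subseteq> E"
    and i: "mixed_monotone n A B X le F"
    and ii: "O_continuous n X d le F \<or> ordered_metric_space.MCB E d le"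
    and iii: "\<exists>x\<in>tuples n X.
        ((\<forall>i\<in>A. le (x i) (F (reindex n ast i x))) \<and>
         (\<forall>i\<in>B. le (F (reindex n ast i x)) (x i))) \<or>
        ((\<forall>i\<in>A. le (F (reindex n ast i x)) (x i)) \<and>
         (\<forall>i\<in>B. le (x i) (F (reindex n ast i x))))"
    and iv: "(\<exists>\<phi>\<in>Omega. \<forall>x\<in>tuples n X. \<forall>y\<in>tuples n X. comparable (mixed_le le A B) x y \<longrightarrow>
          (1 / real n) * (\<Sum>i=1..n. d (F (reindex n ast i x)) (F (reindex n ast i y)))
            \<le> \<phi> ((1 / real n) * (\<Sum>i=1..n. d (x i) (y i)))) \<or>
        (\<exists>\<phi>\<in>Omega. \<forall>x\<in>tuples n X. \<forall>y\<in>tuples n X. comparable (mixed_le le A B) x y \<longrightarrow>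
          Max ((\<lambda>i. d (F (reindex n ast i x)) (F (reindex n ast i y))) ` {1..n})
            \<le> \<phi> (Max ((\<lambda>i. d (x i) (y i)) ` {1..n})))"
    and connected: "\<forall>x\<in>tuples n X. \<forall>y\<in>tuples n X. \<exists>z\<in>tuples n X.
        comparable (mixed_le le A B) z x \<and> comparable (mixed_le le A B) z y"
  shows "\<exists>!x. ast_fixed_point n ast X F x"
proof -
  let ?T = "tuple_map n ast F" and ?R = "mixed_le le A B"
  note E = subspace
  interpret ordered_metric_space X d le by fact
  have AB: "A \<union> B = {1..n}"
    using partition by (simp add: is_bipartition_def)
  have maps: "ast \<in> {1..n} \<times> {1..n} \<rightarrow> {1..n}"
    using ast by (simp add: admissible_ops_def)
  have n0: "n > 0" using n by simp
  let ?contraction = "\<lambda>D \<phi>. \<forall>x\<in>tuples n X. \<forall>y\<in>tuples n X. comparable ?R x y \<longrightarrow>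
      D (?T x) (?T y) \<le> \<phi> (D x y)"
  have "\<exists>D. tuple_metric n X d D \<and> (\<exists>\<phi>\<in>Omega. ?contraction D \<phi>)"
    using iv
  proof
    let ?D = "\<lambda>x y. (1 / real n) * (\<Sum>i=1..n. d (x i) (y i))"
    assume "\<exists>\<phi>\<in>Omega. \<forall>x\<in>tuples n X. \<forall>y\<in>tuples n X. comparable ?R x y \<longrightarrow>
        (1 / real n) * (\<Sum>i=1..n. d (F (reindex n ast i x)) (F (reindex n ast i y))) \<le> \<phi> (?D x y)"
    moreover have "?D (?T x) (?T y) =
        (1 / real n) * (\<Sum>i=1..n. d (F (reindex n ast i x)) (F (reindex n ast i y)))" for x y
      by (simp add: tuple_map_apply)
    ultimately have "\<exists>\<phi>\<in>Omega. ?contraction ?D \<phi>"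
      by (simp only:)
    with tuple_metric_average[OF Metric_space_axioms n0] show ?thesis
      by blast
  next
    let ?D = "\<lambda>x y. Max ((\<lambda>i. d (x i) (y i)) ` {1..n})"
    assume "\<exists>\<phi>\<in>Omega. \<forall>x\<in>tuples n X. \<forall>y\<in>tuples n X. comparable ?R x y \<longrightarrow>
        Max ((\<lambda>i. d (F (reindex n ast i x)) (F (reindex n ast i y))) ` {1..n}) \<le> \<phi> (?D x y)"
    moreover have "?D (?T x) (?T y) =
        Max ((\<lambda>i. d (F (reindex n ast i x)) (F (reindex n ast i y))) ` {1..n})" for x y
      by (intro arg_cong[of _ _ Max] image_cong) (auto simp: tuple_map_apply)
    ultimately have "\<exists>\<phi>\<in>Omega. ?contraction ?D \<phi>"
      by (simp only:)
    with tuple_metric_Max[OF Metric_space_axioms n0] show ?thesis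
      by blast
  qed
  then obtain D \<phi> where D: "tuple_metric n X d D" and \<phi>: "\<phi> \<in> Omega" "?contraction D \<phi>"
    by blast
  interpret D: tuple_metric n X d D by fact
  interpret DM: Metric_space "tuples n X" D by (rule D.Metric_space_tuples)
  have T_in: "?T x \<in> tuples n X" if "x \<in> tuples n X" for x
    using tuple_map_in_tuples[OF maps _ that, of F X] F by auto
  have MK: "\<exists>\<delta>>0. \<forall>x\<in>tuples n X. \<forall>y\<in>tuples n X. comparable ?R x y \<longrightarrow>
      D x y < t + \<delta> \<longrightarrow> D (?T x) (?T y) < t" if t: "t > 0" for t
  proof -
    obtain \<delta> where \<delta>: "\<delta> > 0" "\<And>r. 0 < r \<Longrightarrow> r < t + \<delta> \<Longrightarrow> \<phi> r < t"
      using Omega_less_right[OF \<phi>(1) t] by blast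
    have "D (?T x) (?T y) < t"
      if xy: "x \<in> tuples n X" "y \<in> tuples n X" "comparable ?R x y" "D x y < t + \<delta>" for x y
    proof (cases "x = y")
      \<comment> \<open>\<open>\<phi> 0\<close> may be positive, so the contraction inequality says nothing here.\<close>
      case True
      then show ?thesis using t T_in[OF xy(1)] by simp
    next
      case False
      then have "\<phi> (D x y) < t"
        using \<delta>(2) xy by auto
      moreover have "D (?T x) (?T y) \<le> \<phi> (D x y)"
        using \<phi>(2) xy by blast
      ultimately show ?thesis by simp
    qed
    with \<delta>(1) show ?thesis by blast
  qed
  interpret T: Meir_Keeler_on_comparable "tuples n X" D ?R ?T
    by unfold_locales
      (use T_in MK tuple_map_isotone[OF AB le_refl le_trans F i ast]
        mixed_le_refl[OF AB le_refl] mixed_le_trans[OF AB le_trans] in blast)+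
  \<comment> \<open>Comparability is the same for an order and its converse, so the contraction
    condition carries over to the reversed order, which serves a starting point with
    \<open>?T u\<close> below \<open>u\<close>.\<close>
  have T': "Meir_Keeler_on_comparable (tuples n X) D (mixed_le le B A) ?T"
  proof -
    have BA: "B \<union> A = {1..n}" using AB by blast
    have "comparable (mixed_le le B A) x y = comparable ?R x y" for x y
      by (auto simp: comparable_def mixed_le_swap[of le B A])
    with MK show ?thesis
      by unfold_locales
        (use T_in T.isotone mixed_le_refl[OF BA le_refl] mixed_le_trans[OF BA le_trans] in
          \<open>simp_all add: mixed_le_swap[of le B A]\<close>)
  qed
  obtain u where u: "u \<in> tuples n X" "?R u (?T u) \<or> mixed_le le B A u (?T u)"
  proof -
    have "j \<in> {1..n}" if "j \<in> A \<or> j \<in> B" for j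
      using AB that by blast
    then show ?thesis
      using iii that by (auto simp: mixed_le_def tuple_map_apply)
  qed
  from u(2) have "\<exists>x. ast_fixed_point n ast X F x"
  proof
    assume "?R u (?T u)"
    with AB space maps E complete range ii D T.Meir_Keeler_on_comparable_axioms u(1)
    show ?thesis by (rule ex_ast_fixed_point)
  next
    have BA: "B \<union> A = {1..n}" using AB by blast
    assume "mixed_le le B A u (?T u)"
    with BA space maps E complete range ii D T' u(1)
    show ?thesis by (rule ex_ast_fixed_point)
  qed
  moreover have "x = y" if "ast_fixed_point n ast X F x" "ast_fixed_point n ast X F y" for x y
    using that connected T.fixed_point_unique unfolding ast_fixed_point_iff by metis
  ultimately show ?thesis by blast
qed

end
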